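(* Let $P$ be the transition matrix of an ergodic discrete-time birth-and-death chain on $\{0, \dots, d\}$ with stationary probability mass function $\pi$ and nonnegative eigenvalues $0 \le \theta_0 \le \theta_1 \le \dots \le \theta_{d - 1} < \theta_d = 1$. For $k=0,\dots,d$ define $$Q_k := (1 - \theta_0)^{-1} \cdots (1 - \theta_{k-1})^{-1} (P - \theta_0 I) \cdots (P - \theta_{k-1} I),\qquad Q_0:=I.$$ Then the matrices $Q_k$, $0\le k\le d$, are all stochastic, and every row of $Q_d$ equals $\pi$.
   Context: A discrete-time birth-and-death chain on $\{0,\dots,d\}$ has a tridiagonal stochastic transition matrix; ergodic means irreducible and aperiodic. Eigenvalues are listed with multiplicity. $I$ is the identity matrix. A square matrix is stochastic if its entries are nonnegative and each row sums to $1$. *)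

theory Defs
  imports "Jordan_Normal_Form.Char_Poly"
begin

definition stochastic_mat :: "nat \<Rightarrow> real mat \<Rightarrow> bool" where
  "stochastic_mat n A \<longleftrightarrow> A \<in> carrier_mat n n
     \<and> (\<forall>i<n. \<forall>j<n. A $$ (i, j) \<ge> 0)
     \<and> (\<forall>i<n. (\<Sum>j<n. A $$ (i, j)) = 1)"

definition tridiagonal_mat :: "'a :: zero mat \<Rightarrow> bool" where
  "tridiagonal_mat A \<longleftrightarrow>
     (\<forall>i<dim_row A. \<forall>j<dim_col A. i + 1 < j \<or> j + 1 < i \<longrightarrow> A $$ (i, j) = 0)"

definition birth_death_mat :: "nat \<Rightarrow> real mat \<Rightarrow> bool" where
  "birth_death_mat d P \<longleftrightarrow> stochastic_mat (d + 1) P \<and> tridiagonal_mat P"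

definition irreducible_chain :: "real mat \<Rightarrow> bool" where
  "irreducible_chain P \<longleftrightarrow>
     (\<forall>i<dim_row P. \<forall>j<dim_row P. \<exists>m. (P ^\<^sub>m m) $$ (i, j) > 0)"

definition aperiodic_chain :: "real mat \<Rightarrow> bool" where
  "aperiodic_chain P \<longleftrightarrow>
     (\<forall>i<dim_row P. Gcd {m. m \<ge> 1 \<and> (P ^\<^sub>m m) $$ (i, i) > 0} = (1 :: nat))"

definition ergodic_chain :: "real mat \<Rightarrow> bool" where
  "ergodic_chain P \<longleftrightarrow> irreducible_chain P \<and> aperiodic_chain P"

definition stationary_pmf :: "real mat \<Rightarrow> real vec \<Rightarrow> bool" where
  "stationary_pmf P \<pi> \<longleftrightarrow> \<pi> \<in> carrier_vec (dim_row P)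
     \<and> (\<forall>i<dim_row P. \<pi> $ i \<ge> 0)
     \<and> (\<Sum>i<dim_row P. \<pi> $ i) = 1
     \<and> (\<forall>j<dim_row P. (\<Sum>i<dim_row P. \<pi> $ i * P $$ (i, j)) = \<pi> $ j)"

text \<open>The list \<open>\<theta> 0, \<dots>, \<theta> d\<close> consists of all eigenvalues, repeated according to
  algebraic multiplicity; in particular the characteristic polynomial splits over the reals.\<close>

definition eigenvalues_with_multiplicity :: "nat \<Rightarrow> real mat \<Rightarrow> (nat \<Rightarrow> real) \<Rightarrow> bool" where
  "eigenvalues_with_multiplicity d P \<theta> \<longleftrightarrow> char_poly P = (\<Prod>i\<le>d. [:- \<theta> i, 1:])"

primrec shifted_prod :: "real mat \<Rightarrow> (nat \<Rightarrow> real) \<Rightarrow> nat \<Rightarrow> real mat" where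
  "shifted_prod P \<theta> 0 = 1\<^sub>m (dim_row P)"
| "shifted_prod P \<theta> (Suc k) = shifted_prod P \<theta> k * (P - \<theta> k \<cdot>\<^sub>m 1\<^sub>m (dim_row P))"

definition Q_mat :: "real mat \<Rightarrow> (nat \<Rightarrow> real) \<Rightarrow> nat \<Rightarrow> real mat" where
  "Q_mat P \<theta> k = (\<Prod>i<k. inverse (1 - \<theta> i)) \<cdot>\<^sub>m shifted_prod P \<theta> k"

end

theory Submission
  imports Defs
begin

text \<open>
  Irreducibility makes the off-diagonal entries of \<open>P\<close> positive. For such a tridiagonal matrix
  \<open>J\<close> of size \<open>n\<close> with real eigenvalues \<open>\<theta>\<^sub>0 \<le> \<theta>\<^sub>1 \<le> \<dots>\<close>, the leading principal minors of
  \<open>J - \<theta>\<^sub>0\<close> of order less than \<open>n\<close> are positive and \<open>det (J - \<theta>\<^sub>0) = 0\<close>, so the LU decomposition is a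
  factorization \<open>J - \<theta>\<^sub>0 = B C\<close> into nonnegative bidiagonal matrices with inner dimension
  \<open>n - 1\<close>. The matrix \<open>J' = C B + \<theta>\<^sub>0\<close> is again tridiagonal with positive off-diagonal
  entries, has eigenvalues \<open>\<theta>\<^sub>1 \<le> \<theta>\<^sub>2 \<le> \<dots>\<close>, and
  \<open>(J - \<theta>\<^sub>0) (J - \<theta>\<^sub>1) \<dots> (J - \<theta>\<^sub>k) = B (J' - \<theta>\<^sub>1) \<dots> (J' - \<theta>\<^sub>k) C\<close>.
  Induction on \<open>n\<close> shows that all these products are nonnegative and that the full product is
  \<open>0\<close>. Hence the rows of \<open>Q\<^sub>d\<close> are stationary, and a left eigenvector of \<open>P\<close> is
  determined by its first entry.
\<close>

section \<open>Determinants of tridiagonal matrices\<close>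

text \<open>The signed continuant: a tridiagonal determinant depends on the off-diagonal entries
  only through the products \<open>e i\<close> of opposite ones. The commutative ring is arbitrary
  so that entries may be polynomials.\<close>

fun continuant :: "(nat \<Rightarrow> 'a :: comm_ring_1) \<Rightarrow> (nat \<Rightarrow> 'a) \<Rightarrow> nat \<Rightarrow> 'a" where
  "continuant a e 0 = 1"
| "continuant a e (Suc 0) = a 0"
| "continuant a e (Suc (Suc n)) = a (Suc n) * continuant a e (Suc n) - e n * continuant a e n"

definition tridiag :: "nat \<Rightarrow> (nat \<Rightarrow> 'a :: comm_ring_1) \<Rightarrow> (nat \<Rightarrow> 'a) \<Rightarrow> (nat \<Rightarrow> 'a) \<Rightarrow> 'a mat" where
  "tridiag n a b c = mat n n (\<lambda>(i, j).
     if i = j then a i else if j = Suc i then b i else if i = Suc j then c j else 0)"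

lemma tridiag_carrier [simp]: "tridiag n a b c \<in> carrier_mat n n"
  by (simp add: tridiag_def)

lemma dim_tridiag [simp]: "dim_row (tridiag n a b c) = n" "dim_col (tridiag n a b c) = n"
  by (simp_all add: tridiag_def)

lemma index_tridiag [simp]:
  "i < n \<Longrightarrow> j < n \<Longrightarrow> tridiag n a b c $$ (i, j) =
     (if i = j then a i else if j = Suc i then b i else if i = Suc j then c j else 0)"
  by (simp add: tridiag_def)

text \<open>Expansion along the last row leaves two minors. The one belonging to \<open>c n\<close>
  has no nonzero entry but \<open>b n\<close> in its last column, and expanding there reaches the
  matrix two sizes smaller.\<close>

lemma det_tridiag: "det (tridiag n a b c) = continuant a (\<lambda>i. b i * c i) n"
proof (induction a "\<lambda>i. b i * c i" n rule: continuant.induct)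
  case (1 a)
  show ?case by (simp add: det_dim_zero[OF tridiag_carrier])
next
  case (2 a)
  show ?case using det_single[of "tridiag 1 a b c"] by simp
next
  case (3 a n)
  let ?A = "tridiag (Suc (Suc n)) a b c"
  let ?M = "mat_delete ?A (Suc n) n"
  have D1: "mat_delete ?A (Suc n) (Suc n) = tridiag (Suc n) a b c"
    by (rule eq_matI) (auto simp: mat_delete_def)
  have D2: "mat_delete ?M n n = tridiag n a b c"
    by (rule eq_matI) (auto simp: mat_delete_def)
  have M: "?M \<in> carrier_mat (Suc n) (Suc n)"
    by (simp add: mat_delete_def)
  have last: "?M $$ (i, n) = (if i = n then b n else 0)" if "i < Suc n" for i
    using that by (auto simp: mat_delete_def)
  have "det ?M = (\<Sum>i<Suc n. ?M $$ (i, n) * cofactor ?M i n)"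
    by (rule laplace_expansion_column[OF M]) simp
  also have "\<dots> = b n * det (tridiag n a b c)"
    by (simp add: last cofactor_def D2)
  finally have detM: "det ?M = b n * det (tridiag n a b c)" .
  have "det ?A = (\<Sum>j<Suc (Suc n). ?A $$ (Suc n, j) * cofactor ?A (Suc n) j)"
    by (rule laplace_expansion_row[OF tridiag_carrier]) simp
  also have "\<dots> = a (Suc n) * det (tridiag (Suc n) a b c) - c n * det ?M"
    by (simp add: cofactor_def D1)
  finally show ?case
    using 3 by (simp add: detM algebra_simps)
qed

lemma continuant_uminus:
  "continuant (\<lambda>i. - a i) e n = (-1) ^ n * continuant a e n"
  by (induction a e n rule: continuant.induct) (simp_all add: algebra_simps)

text \<open>The determinant of \<open>J - x\<close>, for \<open>J\<close> tridiagonal with diagonal \<open>a\<close> and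
  products \<open>e\<close> of opposite off-diagonal entries.\<close>

definition shifted_continuant :: "(nat \<Rightarrow> real) \<Rightarrow> (nat \<Rightarrow> real) \<Rightarrow> nat \<Rightarrow> real poly" where
  "shifted_continuant a e = continuant (\<lambda>i. [:a i, -1:]) (\<lambda>i. [:e i:])"

lemma shifted_continuant_simps [simp]:
  "shifted_continuant a e 0 = 1"
  "shifted_continuant a e (Suc 0) = [:a 0, -1:]"
  "shifted_continuant a e (Suc (Suc n)) =
     [:a (Suc n), -1:] * shifted_continuant a e (Suc n) - [:e n:] * shifted_continuant a e n"
  by (simp_all add: shifted_continuant_def)

text \<open>Negating the off-diagonal entries keeps the products of opposite ones, so passing from J
  - x to x - J only negates the diagonal.\<close>

lemma char_poly_tridiag:
  "char_poly (tridiag n a b c) = (-1) ^ n * shifted_continuant a (\<lambda>i. b i * c i) n"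
proof -
  have "char_poly_matrix (tridiag n a b c) =
      tridiag n (\<lambda>i. - [:a i, -1:]) (\<lambda>i. [:- b i:]) (\<lambda>i. [:- c i:])"
    by (rule eq_matI) (auto simp: char_poly_matrix_def)
  then have "char_poly (tridiag n a b c) =
      continuant (\<lambda>i. - [:a i, -1:]) (\<lambda>i. [:b i * c i:]) n"
    by (simp add: char_poly_def det_tridiag mult.commute)
  also have "\<dots> = (-1) ^ n * shifted_continuant a (\<lambda>i. b i * c i) n"
    by (subst continuant_uminus) (simp add: shifted_continuant_def)
  finally show ?thesis .
qed

section \<open>Positivity of the leading principal minors\<close>

text \<open>Far to the left the diagonal entries \<open>a i - x\<close> dominate, so the minors do
  not decrease with their order. This provides the left end of the interval in which a first zero is
  sought.\<close>

lemma shifted_continuant_pos_at_bot: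
  assumes "\<And>i. Suc i < n \<Longrightarrow> 0 < e i"
  shows "\<exists>z. \<forall>x\<le>z. 0 < poly (shifted_continuant a e n) x"
proof -
  \<comment> \<open>The choice makes \<open>a i - x\<close> at least
    \<open>1 + \<bar>e j\<bar>\<close> for all relevant \<open>i\<close>, \<open>j\<close> and all
    \<open>x \<le> z\<close>.\<close>
  define z where "z = - (\<Sum>i<n. \<bar>a i\<bar> + \<bar>e i\<bar>) - 1"
  have *: "1 + \<bar>e j\<bar> \<le> a i - x" if "x \<le> z" "i < n" "j < i" for x i j
  proof -
    have "\<bar>a i\<bar> \<le> (\<Sum>i<n. \<bar>a i\<bar>)" "\<bar>e j\<bar> \<le> (\<Sum>i<n. \<bar>e i\<bar>)"
      using that by (auto intro!: member_le_sum)
    then show ?thesis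
      using that by (simp add: z_def sum.distrib)
  qed
  have **: "1 \<le> a 0 - x" if "x \<le> z" "0 < n" for x
  proof -
    have "\<bar>a 0\<bar> \<le> (\<Sum>i<n. \<bar>a i\<bar>)" "0 \<le> (\<Sum>i<n. \<bar>e i\<bar>)"
      using that by (auto intro!: member_le_sum sum_nonneg)
    then show ?thesis
      using that unfolding z_def sum.distrib by linarith
  qed
  \<comment> \<open>Monotonicity in \<open>m\<close> is carried along because it bounds the
    subtracted term of the recurrence by \<open>e k\<close> times the current minor.\<close>
  have "1 \<le> poly (shifted_continuant a e m) x \<and>
      (0 < m \<longrightarrow> poly (shifted_continuant a e (m - 1)) x \<le> poly (shifted_continuant a e m) x)"
    if "m \<le> n" "x \<le> z" for m x
    using that(1)
  proof (induction m)
    case (Suc m)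
    show ?case
    proof (cases m)
      case 0
      then show ?thesis using **[OF that(2)] Suc.prems by simp
    next
      case (Suc k)
      let ?s = "\<lambda>i. poly (shifted_continuant a e i) x"
      have IH: "1 \<le> ?s (Suc k)" "?s k \<le> ?s (Suc k)"
        using Suc.IH Suc.prems Suc by auto
      have e: "0 < e k" using assms Suc.prems Suc by simp
      have "(1 + e k) * ?s (Suc k) \<le> (a (Suc k) - x) * ?s (Suc k)"
        using *[OF that(2), of "Suc k" k] Suc.prems Suc e IH by (intro mult_right_mono) auto
      moreover have "e k * ?s k \<le> e k * ?s (Suc k)"
        using e IH by simp
      ultimately have "?s (Suc k) \<le> ?s (Suc (Suc k))"
        by (simp add: algebra_simps)
      with IH Suc show ?thesis by simp
    qed
  qed simp
  then have "\<forall>x\<le>z. 0 < poly (shifted_continuant a e n) x" by fastforce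
  then show ?thesis ..
qed

text \<open>Write \<open>s\<^sub>m\<close> for \<open>shifted_continuant a e m\<close>. At the first zero \<open>y\<close> of \<open>s\<^sub>m\<close> the recurrence gives
  \<open>s\<^sub>m\<^sub>+\<^sub>1 y = - e\<^sub>m\<^sub>-\<^sub>1 s\<^sub>m\<^sub>-\<^sub>1 y < 0\<close>, so \<open>s\<^sub>m\<close> cannot vanish before \<open>s\<^sub>m\<^sub>+\<^sub>1\<close> has become negative.\<close>

lemma shifted_continuant_pos:
  assumes "\<And>i. Suc i < n \<Longrightarrow> 0 < e i"
    and "\<And>x. x \<le> t \<Longrightarrow> 0 \<le> poly (shifted_continuant a e n) x"
    and "m < n" "x \<le> t"
  shows "0 < poly (shifted_continuant a e m) x"
  using assms
proof (induction n arbitrary: t m x)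
  case (Suc n)
  let ?s = "\<lambda>i. poly (shifted_continuant a e i)"
  have pos: "0 < ?s n x" if "x \<le> t" for x
  proof (cases n)
    case (Suc k)
    show ?thesis
    proof (rule ccontr)
      assume "\<not> 0 < ?s n x"
      then have x: "?s n x \<le> 0" by simp
      obtain z where z: "\<And>x. x \<le> z \<Longrightarrow> 0 < ?s n x"
        using shifted_continuant_pos_at_bot[of n e a] Suc.prems(1) by auto
      have zx: "z \<le> x" using z[of x] x by linarith
      \<comment> \<open>Cutting at \<open>z\<close> loses no point where \<open>?s n\<close> is
        nonpositive and makes the set compact, so it has a least element \<open>y\<close>.\<close>
      let ?S = "{z..x} \<inter> {w. ?s n w \<le> 0}"
      have "compact ?S"
        by (intro compact_Int_closed compact_Icc closed_Collect_le continuous_intros)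
      moreover have "?S \<noteq> {}" using x zx by auto
      ultimately obtain y where y: "y \<in> ?S" and least: "\<And>w. w \<in> ?S \<Longrightarrow> y \<le> w"
        using compact_attains_inf by metis
      \<comment> \<open>The value at \<open>y\<close> is exactly 0: the intermediate value theorem
        gives a zero in \<open>{z..y}\<close>, which lies in \<open>?S\<close> and hence equals
        \<open>y\<close> by minimality.\<close>
      have "\<exists>w\<ge>z. w \<le> y \<and> ?s n w = 0"
        using y z[of z] by (intro IVT2') (auto intro!: continuous_intros)
      then obtain w where w: "z \<le> w" "w \<le> y" "?s n w = 0" by blast
      have "y \<le> w" using w y by (intro least) auto
      with w have y0: "?s n y = 0" by simp
      have "0 \<le> ?s n v" if "v \<le> y" for v
      proof (cases "v = y \<or> v \<le> z")
        case False
        then have "v \<notin> ?S" using least[of v] that by auto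
        with False that y show ?thesis by auto
      qed (use y0 z[of v] in auto)
      \<comment> \<open>The induction hypothesis is used with threshold \<open>y\<close> instead of
        \<open>t\<close>, since \<open>?s n\<close> is known to be nonnegative only up to
        \<open>y\<close>.\<close>
      then have "0 < ?s k y"
        using Suc.IH[of y k y] Suc.prems(1) Suc by auto
      moreover have "0 < e k" using Suc.prems(1)[of k] Suc by simp
      moreover have "0 \<le> ?s (Suc n) y"
        using y that by (intro Suc.prems(2)) auto
      ultimately show False
        using y0 Suc by (simp add: mult_le_0_iff)
    qed
  qed simp
  show ?case
  proof (cases "m = n")
    case False
    have "0 \<le> ?s n x" if "x \<le> t" for x using pos[OF that] by simp
    then show ?thesis
      using Suc.IH[of t m x] Suc.prems False by auto
  qed (use pos Suc.prems in simp)
qed simp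

section \<open>Bidiagonal factors and the Darboux transform\<close>

text \<open>The LU factors of a matrix whose last pivot is 0: the last row of U vanishes, so it is
  dropped together with the last column of L. This makes the factors rectangular.\<close>

definition lower_bidiag :: "nat \<Rightarrow> (nat \<Rightarrow> real) \<Rightarrow> real mat" where
  "lower_bidiag m l = mat (Suc m) m (\<lambda>(i, j). if i = j then 1 else if i = Suc j then l j else 0)"

definition upper_bidiag :: "nat \<Rightarrow> (nat \<Rightarrow> real) \<Rightarrow> (nat \<Rightarrow> real) \<Rightarrow> real mat" where
  "upper_bidiag m u b = mat m (Suc m) (\<lambda>(i, j). if i = j then u i else if j = Suc i then b i else 0)"

lemma bidiag_carrier [simp]:
  "lower_bidiag m l \<in> carrier_mat (Suc m) m" "upper_bidiag m u b \<in> carrier_mat m (Suc m)"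
  by (simp_all add: lower_bidiag_def upper_bidiag_def)

lemma lower_times_upper_bidiag:
  "lower_bidiag m l * upper_bidiag m u b =
     tridiag (Suc m) (\<lambda>i. (if i < m then u i else 0) + (if i = 0 then 0 else b (i - 1) * l (i - 1)))
       b (\<lambda>i. l i * u i)"
proof (rule eq_matI, goal_cases)
  case (1 i j)
  then have ij: "i < Suc m" "j < Suc m" by auto
  \<comment> \<open>Row \<open>i\<close> of the lower factor lives in columns \<open>i\<close> and
    \<open>i - 1\<close>. The guard \<open>i = 0\<close> is needed because \<open>i - 1\<close> is
    then 0 again; for \<open>i = m\<close> column \<open>i\<close> is absent.\<close>
  have "(lower_bidiag m l * upper_bidiag m u b) $$ (i, j) =
      (\<Sum>k<m. (if k = i then upper_bidiag m u b $$ (k, j) else 0) +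
        (if k = i - 1 then if i = 0 then 0 else l k * upper_bidiag m u b $$ (k, j) else 0))"
    using ij by (cases i)
      (auto simp: scalar_prod_def lower_bidiag_def upper_bidiag_def atLeast0LessThan
        simp del: lessThan_Suc sum.lessThan_Suc intro!: sum.cong)
  also have "\<dots> = (if i < m then upper_bidiag m u b $$ (i, j) else 0) +
        (if i = 0 then 0 else l (i - 1) * upper_bidiag m u b $$ (i - 1, j))"
    using ij by (auto simp: sum.distrib)
  also have "\<dots> = tridiag (Suc m) (\<lambda>i. (if i < m then u i else 0) +
      (if i = 0 then 0 else b (i - 1) * l (i - 1))) b (\<lambda>i. l i * u i) $$ (i, j)"
    using ij by (cases i; cases "i = j") (auto simp: upper_bidiag_def mult.commute)
  finally show ?case .
qed (simp_all add: lower_bidiag_def upper_bidiag_def)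

lemma upper_times_lower_bidiag:
  "upper_bidiag m u b * lower_bidiag m l =
     tridiag m (\<lambda>i. u i + b i * l i) b (\<lambda>i. u (Suc i) * l i)"
proof (rule eq_matI, goal_cases)
  case (1 i j)
  then have ij: "i < m" "j < m" by auto
  have "(upper_bidiag m u b * lower_bidiag m l) $$ (i, j) =
      (\<Sum>k<Suc m. (if k = i then u k * lower_bidiag m l $$ (k, j) else 0) +
        (if k = Suc i then b i * lower_bidiag m l $$ (k, j) else 0))"
    using ij unfolding atLeast0LessThan[symmetric]
    by (auto simp: scalar_prod_def lower_bidiag_def upper_bidiag_def simp del: sum.op_ivl_Suc intro!: sum.cong)
  also have "\<dots> = u i * lower_bidiag m l $$ (i, j) + b i * lower_bidiag m l $$ (Suc i, j)"
    using ij by (auto simp: sum.distrib simp del: sum.lessThan_Suc)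
  also have "\<dots> = tridiag m (\<lambda>i. u i + b i * l i) b (\<lambda>i. u (Suc i) * l i) $$ (i, j)"
    using ij by (auto simp: lower_bidiag_def)
  finally show ?case .
qed (simp_all add: lower_bidiag_def upper_bidiag_def)

text \<open>The polynomials of the Darboux transform \<open>CB + t\<close> of \<open>BC + t\<close> are the kernel
  (Christoffel) polynomials of those of \<open>BC + t\<close>.\<close>

lemma shifted_continuant_darboux:
  assumes a: "\<And>i. i \<le> m \<Longrightarrow> a i = t + u i + (if i = 0 then 0 else f (i - 1))"
    and e: "\<And>i. i < m \<Longrightarrow> e i = f i * u i"
    and "k \<le> m"
  shows "[:t, -1:] * shifted_continuant (\<lambda>i. t + u i + f i) (\<lambda>i. f i * u (Suc i)) k =
    shifted_continuant a e (Suc k) - Polynomial.smult (u k) (shifted_continuant a e k)"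
proof -
  let ?s = "shifted_continuant a e"
  let ?r = "shifted_continuant (\<lambda>i. t + u i + f i) (\<lambda>i. f i * u (Suc i))"
  \<comment> \<open>The second identity is the companion of the first; it serves to eliminate
    \<open>?r (k - 1)\<close> from the three-term recurrence of \<open>?r\<close>.\<close>
  have "[:t, -1:] * ?r k = ?s (Suc k) - Polynomial.smult (u k) (?s k) \<and>
      (0 < k \<longrightarrow> ?r k = ?s k + Polynomial.smult (f (k - 1)) (?r (k - 1)))"
    using \<open>k \<le> m\<close>
  proof (induction k)
    case 0
    then show ?case using a[of 0] by simp
  next
    case (Suc k)
    have IH: "[:t, -1:] * ?r k = ?s (Suc k) - Polynomial.smult (u k) (?s k)"
      using Suc by simp
    have r: "?r (Suc k) = ?s (Suc k) + Polynomial.smult (f k) (?r k)"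
    proof (cases k)
      case 0
      then show ?thesis using a[of 0] Suc.prems by simp
    next
      case (Suc i)
      have "?r k = ?s k + Polynomial.smult (f i) (?r i)"
        using Suc.IH Suc.prems Suc by simp
      then have "Polynomial.smult (f i * u k) (?r i) = Polynomial.smult (u k) (?r k) - Polynomial.smult (u k) (?s k)"
        by (simp add: smult_add_right algebra_simps)
      moreover have "[:t + u k + f k, -1:] * ?r k =
          [:t, -1:] * ?r k + Polynomial.smult (u k) (?r k) + Polynomial.smult (f k) (?r k)"
        by (simp add: smult_add_left algebra_simps)
      ultimately show ?thesis
        using IH Suc by simp
    qed
    have "[:t, -1:] * ?r (Suc k) = [:t, -1:] * ?s (Suc k) + Polynomial.smult (f k) ([:t, -1:] * ?r k)"
      unfolding r by (simp add: algebra_simps)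
    also have "\<dots> = [:t, -1:] * ?s (Suc k) + Polynomial.smult (f k) (?s (Suc k)) - Polynomial.smult (f k * u k) (?s k)"
      unfolding IH by (simp add: smult_diff_right)
    also have "\<dots> = ?s (Suc (Suc k)) - Polynomial.smult (u (Suc k)) (?s (Suc k))"
      using a[of "Suc k"] e[of k] Suc.prems by (simp add: smult_add_left algebra_simps)
    finally show ?case using r by simp
  qed
  then show ?thesis by simp
qed

section \<open>Nonnegativity of the shifted products\<close>

lemma shifted_prod_carrier:
  "A \<in> carrier_mat n n \<Longrightarrow> shifted_prod A \<theta> k \<in> carrier_mat n n"
  by (induction k) auto

text \<open>The first factor is \<open>B * C\<close> itself. Each further factor is moved past
  \<open>C\<close> by the intertwining relation C (BC + s) = (CB + s) C.\<close>

lemma shifted_prod_darboux: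
  assumes B: "B \<in> carrier_mat n m" and C: "C \<in> carrier_mat m n"
    and A: "A = B * C + \<theta> 0 \<cdot>\<^sub>m 1\<^sub>m n" and A': "A' = C * B + \<theta> 0 \<cdot>\<^sub>m 1\<^sub>m m"
  shows "shifted_prod A \<theta> (Suc k) = B * shifted_prod A' (\<theta> \<circ> Suc) k * C"
proof (induction k)
  case 0
  have [simp]: "dim_row A = n" "dim_row A' = m" using A A' by auto
  have "A - \<theta> 0 \<cdot>\<^sub>m 1\<^sub>m n = B * C"
    unfolding A using B C by (intro eq_matI) auto
  then show ?case using B C by simp
next
  case (Suc k)
  let ?S = "shifted_prod A' (\<theta> \<circ> Suc) k" and ?t = "\<theta> (Suc k)"
  have Ac: "A \<in> carrier_mat n n" and Ac': "A' \<in> carrier_mat m m" using A A' by auto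
  have S: "?S \<in> carrier_mat m m" by (rule shifted_prod_carrier[OF Ac'])
  have BC: "B * C \<in> carrier_mat n n" and CB: "C * B \<in> carrier_mat m m" using B C by auto
  have "A - ?t \<cdot>\<^sub>m 1\<^sub>m n = B * C + (\<theta> 0 - ?t) \<cdot>\<^sub>m 1\<^sub>m n"
    unfolding A using B C by (intro eq_matI) (auto simp: algebra_simps)
  moreover have "A' - ?t \<cdot>\<^sub>m 1\<^sub>m m = C * B + (\<theta> 0 - ?t) \<cdot>\<^sub>m 1\<^sub>m m"
    unfolding A' using B C by (intro eq_matI) (auto simp: algebra_simps)
  moreover have "C * (B * C + (\<theta> 0 - ?t) \<cdot>\<^sub>m 1\<^sub>m n) = C * (B * C) + (\<theta> 0 - ?t) \<cdot>\<^sub>m C"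
    using BC C by (simp add: mult_add_distrib_mat[OF C BC] mult_smult_distrib[OF C one_carrier_mat])
  moreover have "(C * B + (\<theta> 0 - ?t) \<cdot>\<^sub>m 1\<^sub>m m) * C = C * B * C + (\<theta> 0 - ?t) \<cdot>\<^sub>m C"
    using CB C by (simp add: add_mult_distrib_mat[OF CB _ C] mult_smult_assoc_mat[of _ m m])
  ultimately have comm: "C * (A - ?t \<cdot>\<^sub>m 1\<^sub>m n) = (A' - ?t \<cdot>\<^sub>m 1\<^sub>m m) * C"
    using assoc_mult_mat[OF C B C] by simp
  have T: "A - ?t \<cdot>\<^sub>m 1\<^sub>m n \<in> carrier_mat n n" "A' - ?t \<cdot>\<^sub>m 1\<^sub>m m \<in> carrier_mat m m"
    using Ac Ac' by auto
  have BS: "B * ?S \<in> carrier_mat n m" using B S by auto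
  have "shifted_prod A \<theta> (Suc (Suc k)) = B * ?S * C * (A - ?t \<cdot>\<^sub>m 1\<^sub>m n)"
    using Suc.IH Ac shifted_prod.simps(2)[of A \<theta> "Suc k"] by (simp only: carrier_matD)
  also have "\<dots> = B * ?S * (C * (A - ?t \<cdot>\<^sub>m 1\<^sub>m n))"
    by (rule assoc_mult_mat[OF BS C T(1)])
  also have "\<dots> = B * ?S * (A' - ?t \<cdot>\<^sub>m 1\<^sub>m m) * C"
    unfolding comm by (rule assoc_mult_mat[OF BS T(2) C, symmetric])
  also have "B * ?S * (A' - ?t \<cdot>\<^sub>m 1\<^sub>m m) = B * shifted_prod A' (\<theta> \<circ> Suc) (Suc k)"
    using assoc_mult_mat[OF B S T(2)] Ac' by simp
  finally show ?case .
qed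

definition nonneg_entries :: "real mat \<Rightarrow> bool" where
  "nonneg_entries A \<longleftrightarrow> (\<forall>i<dim_row A. \<forall>j<dim_col A. 0 \<le> A $$ (i, j))"

lemma nonneg_entries_mult:
  assumes "nonneg_entries A" "nonneg_entries B" "dim_col A = dim_row B"
  shows "nonneg_entries (A * B)"
  using assms by (auto simp: nonneg_entries_def scalar_prod_def intro!: sum_nonneg)

text \<open>The class of tridiagonal matrices with positive off-diagonal entries is kept by the
  transform, whereas row sums need not be; hence stochasticity is left out of the induction. The
  second conjunct is the Cayley-Hamilton identity, obtained along the way.\<close>

lemma shifted_prod_tridiag:
  assumes "\<And>i. Suc i < n \<Longrightarrow> 0 < b i" "\<And>i. Suc i < n \<Longrightarrow> 0 < c i"
    and "shifted_continuant a (\<lambda>i. b i * c i) n = (\<Prod>i<n. [:\<theta> i, -1:])"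
    and "\<And>i j. i \<le> j \<Longrightarrow> j < n \<Longrightarrow> \<theta> i \<le> \<theta> j"
  shows "(\<forall>k\<le>n. nonneg_entries (shifted_prod (tridiag n a b c) \<theta> k)) \<and>
    shifted_prod (tridiag n a b c) \<theta> n = 0\<^sub>m n n"
  using assms
proof (induction n arbitrary: a b c \<theta>)
  case 0
  \<comment> \<open>In dimension 0 the identity matrix is also the zero matrix.\<close>
  show ?case by (auto simp: nonneg_entries_def intro!: eq_matI)
next
  case (Suc m)
  define e where "e = (\<lambda>i. b i * c i)"
  \<comment> \<open>\<open>s i\<close> is the leading principal minor of order \<open>i\<close> of J
    - \<open>\<theta> 0\<close>, so the ratios \<open>u i\<close> are the pivots of Gaussian
    elimination and the \<open>l i\<close> its multipliers.\<close>
  define s where "s = (\<lambda>i. poly (shifted_continuant a e i) (\<theta> 0))"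
  define u where "u = (\<lambda>i. s (Suc i) / s i)"
  define l where "l = (\<lambda>i. c i / u i)"
  define f where "f = (\<lambda>i. b i * l i)"
  have e_pos: "0 < e i" if "Suc i < Suc m" for i
    using Suc.prems(1,2) that by (simp add: e_def)
  have split: "(\<Prod>i<Suc m. [:\<theta> i, -1:]) = [:\<theta> 0, -1:] * (\<Prod>i<m. [:(\<theta> \<circ> Suc) i, -1:])"
    by (simp only: prod.lessThan_Suc_shift comp_def)
  \<comment> \<open>Up to the least eigenvalue every factor \<open>\<theta> i - x\<close> is
    nonnegative, so \<open>shifted_continuant_pos\<close> applies with threshold
    \<open>\<theta> 0\<close>.\<close>
  have "0 \<le> poly (shifted_continuant a e (Suc m)) x" if "x \<le> \<theta> 0" for x
  proof -
    have "x \<le> \<theta> i" if "i < Suc m" for i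
      using Suc.prems(4)[of 0 i] that \<open>x \<le> \<theta> 0\<close> by simp
    then show ?thesis
      unfolding e_def Suc.prems(3) poly_prod by (intro prod_nonneg) auto
  qed
  then have s_pos: "0 < s i" if "i < Suc m" for i
    unfolding s_def using shifted_continuant_pos[of "Suc m" e "\<theta> 0" a i] e_pos that by auto
  have s_last: "s (Suc m) = 0"
    unfolding s_def e_def Suc.prems(3) split by simp
  have u_pos: "0 < u i" if "i < m" for i
    using s_pos that by (simp add: u_def)
  have u_last: "u m = 0" by (simp add: u_def s_last)
  have l_pos: "0 < l i" if "i < m" for i
    using u_pos Suc.prems(2) that by (simp add: l_def)
  have lu: "l i * u i = c i" if "i < m" for i
    using u_pos[OF that] by (simp add: l_def)
  \<comment> \<open>This is the diagonal of BC + \<open>\<theta> 0\<close>; dividing the recurrence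
    of the minors by \<open>s (Suc k)\<close> turns it into the recurrence of the pivots.\<close>
  have a_eq: "a i = \<theta> 0 + u i + (if i = 0 then 0 else f (i - 1))" if "i \<le> m" for i
  proof (cases i)
    case 0
    then show ?thesis by (simp add: u_def s_def)
  next
    case (Suc k)
    have "s (Suc (Suc k)) = (a (Suc k) - \<theta> 0) * s (Suc k) - e k * s k"
      by (simp add: s_def algebra_simps)
    moreover have "s (Suc k) \<noteq> 0" "s k \<noteq> 0" using s_pos that Suc by (simp_all add: less_imp_neq[symmetric])
    ultimately have "u (Suc k) = a (Suc k) - \<theta> 0 - f k"
      by (simp add: u_def f_def l_def e_def field_simps)
    then show ?thesis using Suc by simp
  qed
  have e_eq: "e i = f i * u i" if "i < m" for i
    using lu[OF that] by (simp add: e_def f_def)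
  define a' where "a' = (\<lambda>i. \<theta> 0 + u i + f i)"
  define c' where "c' = (\<lambda>i. u (Suc i) * l i)"
  let ?A = "tridiag (Suc m) a b c" and ?A' = "tridiag m a' b c'"
  let ?B = "lower_bidiag m l" and ?C = "upper_bidiag m u b"
  have bc': "(\<lambda>i. b i * c' i) = (\<lambda>i. f i * u (Suc i))"
    by (simp add: c'_def f_def fun_eq_iff)
  \<comment> \<open>At index \<open>m\<close> the second term of the Christoffel identity disappears
    because \<open>u m = 0\<close>. The transform therefore removes exactly the factor of
    \<open>\<theta> 0\<close>.\<close>
  have "[:\<theta> 0, -1:] * shifted_continuant a' (\<lambda>i. b i * c' i) m = shifted_continuant a e (Suc m)"
    using shifted_continuant_darboux[OF a_eq e_eq, where k = m and m = m] u_last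
    unfolding bc' a'_def by (simp del: mult_pCons_left)
  also have "\<dots> = [:\<theta> 0, -1:] * (\<Prod>i<m. [:(\<theta> \<circ> Suc) i, -1:])"
    using Suc.prems(3) unfolding e_def split .
  finally have cont: "shifted_continuant a' (\<lambda>i. b i * c' i) m = (\<Prod>i<m. [:(\<theta> \<circ> Suc) i, -1:])"
    by (subst (asm) mult_cancel_left) simp
  have IH: "(\<forall>k\<le>m. nonneg_entries (shifted_prod ?A' (\<theta> \<circ> Suc) k)) \<and>
      shifted_prod ?A' (\<theta> \<circ> Suc) m = 0\<^sub>m m m"
    using Suc.prems(1,4) u_pos l_pos cont by (intro Suc.IH) (auto simp: c'_def)
  have A: "?A = ?B * ?C + \<theta> 0 \<cdot>\<^sub>m 1\<^sub>m (Suc m)"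
    unfolding lower_times_upper_bidiag
    using a_eq lu u_last by (intro eq_matI) (auto simp: f_def less_Suc_eq)
  have A': "?A' = ?C * ?B + \<theta> 0 \<cdot>\<^sub>m 1\<^sub>m m"
    unfolding upper_times_lower_bidiag by (intro eq_matI) (auto simp: a'_def c'_def f_def)
  have fact: "shifted_prod ?A \<theta> (Suc k) = ?B * shifted_prod ?A' (\<theta> \<circ> Suc) k * ?C" for k
    by (rule shifted_prod_darboux[where \<theta> = \<theta>, OF bidiag_carrier A A'])
  have dims: "dim_row (shifted_prod ?A' (\<theta> \<circ> Suc) k) = m" "dim_col (shifted_prod ?A' (\<theta> \<circ> Suc) k) = m" for k
    using shifted_prod_carrier[OF tridiag_carrier] by (metis carrier_matD)+
  have BC: "nonneg_entries ?B" "nonneg_entries ?C"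
    using l_pos u_pos Suc.prems(1)
    by (auto simp: nonneg_entries_def lower_bidiag_def upper_bidiag_def less_imp_le)
  have "nonneg_entries (shifted_prod ?A \<theta> k)" if "k \<le> Suc m" for k
  proof (cases k)
    case (Suc i)
    show ?thesis
      unfolding Suc fact using IH that Suc BC dims carrier_matD[OF bidiag_carrier(1)[of m l]]
        carrier_matD[OF bidiag_carrier(2)[of m u b]]
      by (intro nonneg_entries_mult) auto
  qed (auto simp: nonneg_entries_def)
  moreover have "shifted_prod ?A \<theta> (Suc m) = 0\<^sub>m (Suc m) (Suc m)"
    unfolding fact using IH left_mult_zero_mat[OF bidiag_carrier(2)]
      right_mult_zero_mat[OF bidiag_carrier(1)] by simp
  ultimately show ?case by blast
qed

section \<open>Irreducibility, left eigenvectors and row sums\<close>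

text \<open>A path leaving \<open>S\<close> must do so in a single step. It is applied to initial
  and final segments of the state space.\<close>

lemma pow_mat_eq_0_of_closed:
  assumes P: "P \<in> carrier_mat n n"
    and closed: "\<And>i j. i < n \<Longrightarrow> j < n \<Longrightarrow> i \<in> S \<Longrightarrow> j \<notin> S \<Longrightarrow> P $$ (i, j) = 0"
    and "i < n" "j < n" "i \<in> S" "j \<notin> S"
  shows "(P ^\<^sub>m m) $$ (i, j) = (0 :: real)"
  using assms(3-)
proof (induction m arbitrary: j)
  case 0
  then show ?case using P by auto
next
  case (Suc m)
  have "P ^\<^sub>m m \<in> carrier_mat n n" using P by simp
  then have "(P ^\<^sub>m Suc m) $$ (i, j) = (\<Sum>k<n. (P ^\<^sub>m m) $$ (i, k) * P $$ (k, j))"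
    using P Suc.prems by (auto simp: scalar_prod_def atLeast0LessThan)
  also have "\<dots> = 0"
    using Suc closed by (intro sum.neutral) (metis lessThan_iff mult_eq_0_iff)
  finally show ?case .
qed

text \<open>A zero above the diagonal would make \<open>{..i}\<close> closed and a zero below it
  would make \<open>{i<..}\<close> closed, against irreducibility.\<close>

lemma irreducible_birth_death_pos:
  assumes bd: "birth_death_mat d P" and irr: "irreducible_chain P" and i: "i < d"
  shows "0 < P $$ (i, Suc i)" "0 < P $$ (Suc i, i)"
proof -
  have P: "P \<in> carrier_mat (Suc d) (Suc d)"
    and nonneg: "\<And>i j. i < Suc d \<Longrightarrow> j < Suc d \<Longrightarrow> 0 \<le> P $$ (i, j)"
    and tri: "\<And>i j. i < Suc d \<Longrightarrow> j < Suc d \<Longrightarrow> i + 1 < j \<or> j + 1 < i \<Longrightarrow> P $$ (i, j) = 0"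
    using bd by (auto simp: birth_death_mat_def stochastic_mat_def tridiagonal_mat_def)
  have reach: "\<exists>m. 0 < (P ^\<^sub>m m) $$ (i, j)" if "i < Suc d" "j < Suc d" for i j
    using irr that P by (auto simp: irreducible_chain_def)
  have "P $$ (i, Suc i) \<noteq> 0"
  proof
    assume 0: "P $$ (i, Suc i) = 0"
    have "P $$ (k, j) = 0" if "k < Suc d" "j < Suc d" "k \<in> {..i}" "j \<notin> {..i}" for k j
      using tri[of k j] 0 that by (cases "k = i \<and> j = Suc i") auto
    then have "(P ^\<^sub>m m) $$ (i, Suc i) = 0" for m
      using pow_mat_eq_0_of_closed[OF P, of "{..i}" i "Suc i" m] i by auto
    then show False using reach[of i "Suc i"] i by auto
  qed
  then show "0 < P $$ (i, Suc i)" using nonneg[of i "Suc i"] i by simp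
  have "P $$ (Suc i, i) \<noteq> 0"
  proof
    assume 0: "P $$ (Suc i, i) = 0"
    have "P $$ (k, j) = 0" if "k < Suc d" "j < Suc d" "k \<in> {i<..}" "j \<notin> {i<..}" for k j
      using tri[of k j] 0 that by (cases "k = Suc i \<and> j = i") auto
    then have "(P ^\<^sub>m m) $$ (Suc i, i) = 0" for m
      using pow_mat_eq_0_of_closed[OF P, of "{i<..}" "Suc i" i m] i by auto
    then show False using reach[of "Suc i" i] i by auto
  qed
  then show "0 < P $$ (Suc i, i)" using nonneg[of "Suc i" i] i by simp
qed

text \<open>Column \<open>i\<close> of the eigenvector equation expresses
  \<open>v (Suc i) * c i\<close> through earlier entries, so \<open>v 0\<close> determines
  \<open>v\<close>.\<close>

lemma tridiag_left_eigen_eq_0: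
  fixes v :: "nat \<Rightarrow> real"
  assumes c: "\<And>i. Suc i < n \<Longrightarrow> c i \<noteq> 0"
    and v: "\<And>j. j < n \<Longrightarrow> (\<Sum>i<n. v i * tridiag n a b c $$ (i, j)) = t * v j"
    and "v 0 = 0" "j < n"
  shows "v j = 0"
  using \<open>j < n\<close>
proof (induction j rule: less_induct)
  case (less j)
  show ?case
  proof (cases j)
    case (Suc i)
    have "t * v i = (\<Sum>k<n. v k * tridiag n a b c $$ (k, i))"
      using v[of i] less.prems Suc by simp
    also have "\<dots> = (\<Sum>k<n. if k = Suc i then v k * c i else 0)"
    proof (intro sum.cong refl)
      fix k assume "k \<in> {..<n}"
      then show "v k * tridiag n a b c $$ (k, i) = (if k = Suc i then v k * c i else 0)"
        using less.IH[of k] less.prems Suc by (cases "k < Suc i") auto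
    qed
    also have "\<dots> = v j * c i" using less.prems Suc by simp
    finally show ?thesis using less.IH[of i] less.prems Suc c[of i] by simp
  qed (use assms in simp)
qed

lemma tridiagonal_mat_eq_tridiag:
  assumes "P \<in> carrier_mat n n" "tridiagonal_mat P"
  shows "P = tridiag n (\<lambda>i. P $$ (i, i)) (\<lambda>i. P $$ (i, Suc i)) (\<lambda>i. P $$ (Suc i, i))"
proof (rule eq_matI, goal_cases)
  case (1 i j)
  then have "i < n" "j < n" by auto
  moreover have "i + 1 < j \<or> j + 1 < i" if "i \<noteq> j" "j \<noteq> Suc i" "i \<noteq> Suc j"
    using that by linarith
  ultimately show ?case using assms by (auto simp: tridiagonal_mat_def)
qed (use assms in auto)

text \<open>The all-ones vector is an eigenvector of each factor, with eigenvalue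
  \<open>1 - \<theta> l\<close>; this is what the normalization of \<open>Q_mat\<close>
  cancels.\<close>

lemma shifted_prod_row_sum:
  assumes P: "P \<in> carrier_mat n n" and rows: "\<And>i. i < n \<Longrightarrow> (\<Sum>j<n. P $$ (i, j)) = 1"
    and "i < n"
  shows "(\<Sum>j<n. shifted_prod P \<theta> k $$ (i, j)) = (\<Prod>l<k. 1 - \<theta> l)"
proof (induction k)
  case 0
  then show ?case using P \<open>i < n\<close> by simp
next
  case (Suc k)
  let ?S = "shifted_prod P \<theta> k" and ?T = "P - \<theta> k \<cdot>\<^sub>m 1\<^sub>m n"
  have S: "?S \<in> carrier_mat n n" by (rule shifted_prod_carrier[OF P])
  have T: "(\<Sum>j<n. ?T $$ (l, j)) = 1 - \<theta> k" if "l < n" for l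
  proof -
    have "(\<Sum>j<n. ?T $$ (l, j)) = (\<Sum>j<n. P $$ (l, j) - (if j = l then \<theta> k else 0))"
      using P that by (intro sum.cong) auto
    then show ?thesis using rows that by (simp add: sum_subtractf)
  qed
  have "(\<Sum>j<n. shifted_prod P \<theta> (Suc k) $$ (i, j)) = (\<Sum>j<n. \<Sum>l<n. ?S $$ (i, l) * ?T $$ (l, j))"
    using P S \<open>i < n\<close> by (intro sum.cong) (auto simp: scalar_prod_def atLeast0LessThan)
  also have "\<dots> = (\<Sum>l<n. ?S $$ (i, l) * (\<Sum>j<n. ?T $$ (l, j)))"
    by (subst sum.swap) (simp add: sum_distrib_left)
  also have "\<dots> = (\<Sum>l<n. ?S $$ (i, l)) * (1 - \<theta> k)"
    using T by (simp add: sum_distrib_right del: index_minus_mat)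
  finally show ?case using Suc.IH by simp
qed

section \<open>Stochasticity of the \<open>Q_mat P \<theta> k\<close> and the rows of the last
  one\<close>

theorem lemma4p1:
  fixes d :: nat and P :: "real mat" and \<pi> :: "real vec" and \<theta> :: "nat \<Rightarrow> real"
  assumes "birth_death_mat d P"
    and "ergodic_chain P"
    and "stationary_pmf P \<pi>"
    and "eigenvalues_with_multiplicity d P \<theta>"
    and "0 \<le> \<theta> 0"
    and "\<forall>i j. i \<le> j \<and> j \<le> d \<longrightarrow> \<theta> i \<le> \<theta> j"
    and "\<forall>i<d. \<theta> i < \<theta> d"
    and "\<theta> d = 1"
  shows "(\<forall>k\<le>d. stochastic_mat (d + 1) (Q_mat P \<theta> k))
    \<and> (\<forall>i\<le>d. row (Q_mat P \<theta> d) i = \<pi>)"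
proof -
  define a b c where "a = (\<lambda>i. P $$ (i, i))" and "b = (\<lambda>i. P $$ (i, Suc i))"
    and "c = (\<lambda>i. P $$ (Suc i, i))"
  have P: "P \<in> carrier_mat (Suc d) (Suc d)"
    and rows: "\<And>i. i < Suc d \<Longrightarrow> (\<Sum>j<Suc d. P $$ (i, j)) = 1"
    and tri: "tridiagonal_mat P"
    using assms(1) by (auto simp: birth_death_mat_def stochastic_mat_def)
  have dimP: "dim_row P = Suc d" using P by simp
  have Pt: "P = tridiag (Suc d) a b c"
    unfolding a_def b_def c_def by (rule tridiagonal_mat_eq_tridiag[OF P tri])
  have bc: "0 < b i" "0 < c i" if "Suc i < Suc d" for i
    using irreducible_birth_death_pos[OF assms(1)] assms(2) that
    by (auto simp: ergodic_chain_def b_def c_def)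
  have "(-1) ^ Suc d * shifted_continuant a (\<lambda>i. b i * c i) (Suc d) = (\<Prod>i<Suc d. - [:\<theta> i, -1:])"
    using assms(4) char_poly_tridiag[of "Suc d" a b c] Pt
    by (simp add: eigenvalues_with_multiplicity_def lessThan_Suc_atMost del: prod.lessThan_Suc)
  also have "\<dots> = (-1) ^ Suc d * (\<Prod>i<Suc d. [:\<theta> i, -1:])"
    by (subst prod_uminus) simp
  finally have "shifted_continuant a (\<lambda>i. b i * c i) (Suc d) = (\<Prod>i<Suc d. [:\<theta> i, -1:])"
    by (subst (asm) mult_cancel_left) simp
  then have main: "(\<forall>k\<le>Suc d. nonneg_entries (shifted_prod P \<theta> k)) \<and>
      shifted_prod P \<theta> (Suc d) = 0\<^sub>m (Suc d) (Suc d)"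
    unfolding Pt using assms(6) bc by (intro shifted_prod_tridiag) auto
  have S: "shifted_prod P \<theta> k \<in> carrier_mat (Suc d) (Suc d)" for k
    by (rule shifted_prod_carrier[OF P])
  have Q: "Q_mat P \<theta> k \<in> carrier_mat (Suc d) (Suc d)" for k
    using S by (simp add: Q_mat_def)
  have lt1: "\<theta> i < 1" if "i < d" for i using assms(7,8) that by simp
  have sto: "stochastic_mat (d + 1) (Q_mat P \<theta> k)" if "k \<le> d" for k
  proof -
    have pos: "0 < (\<Prod>i<k. inverse (1 - \<theta> i))"
      using lt1 that by (intro prod_pos) auto
    have inv: "(\<Prod>i<k. inverse (1 - \<theta> i)) * (\<Prod>i<k. 1 - \<theta> i) = 1"
      unfolding prod.distrib[symmetric] using lt1 that by (intro prod.neutral) (auto simp: less_imp_neq)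
    have "0 \<le> shifted_prod P \<theta> k $$ (i, j)" if "i < Suc d" "j < Suc d" for i j
      using main \<open>k \<le> d\<close> that S[of k] by (auto simp: nonneg_entries_def)
    then have "0 \<le> Q_mat P \<theta> k $$ (i, j)" if "i < Suc d" "j < Suc d" for i j
      using that S[of k] pos by (simp add: Q_mat_def)
    moreover have "(\<Sum>j<Suc d. Q_mat P \<theta> k $$ (i, j)) = 1" if "i < Suc d" for i
    proof -
      have "(\<Sum>j<Suc d. Q_mat P \<theta> k $$ (i, j)) =
          (\<Prod>i<k. inverse (1 - \<theta> i)) * (\<Sum>j<Suc d. shifted_prod P \<theta> k $$ (i, j))"
        unfolding sum_distrib_left using S[of k] that by (intro sum.cong) (auto simp: Q_mat_def)
      then show ?thesis
        using shifted_prod_row_sum[OF P rows that] inv by simp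
    qed
    ultimately show ?thesis using Q[of k] by (simp add: stochastic_mat_def)
  qed
  have "row (Q_mat P \<theta> d) i = \<pi>" if "i \<le> d" for i
  proof -
    let ?r = "\<lambda>j. Q_mat P \<theta> d $$ (i, j)"
    have sum_r: "(\<Sum>j<Suc d. ?r j) = 1"
      using sto[of d] that by (simp add: stochastic_mat_def)
    have pi: "dim_vec \<pi> = Suc d" "(\<Sum>j<Suc d. \<pi> $ j) = 1"
      "\<And>j. j < Suc d \<Longrightarrow> (\<Sum>i<Suc d. \<pi> $ i * P $$ (i, j)) = \<pi> $ j"
      using assms(3) unfolding stationary_pmf_def dimP by auto
    \<comment> \<open>The full product vanishes and its last factor is P - I, since
      \<open>\<theta> d = 1\<close>. Hence the row is a left fixed vector of
      \<open>P\<close>.\<close>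
    have r: "(\<Sum>l<Suc d. ?r l * P $$ (l, j)) = ?r j" if j: "j < Suc d" for j
    proof -
      have "0 = shifted_prod P \<theta> (Suc d) $$ (i, j)"
        using main j \<open>i \<le> d\<close> by simp
      also have "\<dots> = (\<Sum>l<Suc d. shifted_prod P \<theta> d $$ (i, l) * (P $$ (l, j) - (if l = j then 1 else 0)))"
        using P S[of d] j \<open>i \<le> d\<close> assms(8) unfolding atLeast0LessThan[symmetric]
        by (auto simp: scalar_prod_def simp del: sum.op_ivl_Suc intro!: sum.cong)
      finally have "0 = (\<Prod>i<d. inverse (1 - \<theta> i)) *
          (\<Sum>l<Suc d. shifted_prod P \<theta> d $$ (i, l) * (P $$ (l, j) - (if l = j then 1 else 0)))"
        by simp
      also have "\<dots> = (\<Sum>l<Suc d. ?r l * P $$ (l, j) - (if l = j then ?r l else 0))"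
        unfolding sum_distrib_left using S[of d] \<open>i \<le> d\<close>
        by (intro sum.cong) (auto simp: Q_mat_def algebra_simps)
      also have "\<dots> = (\<Sum>l<Suc d. ?r l * P $$ (l, j)) - ?r j"
        using j by (simp add: sum_subtractf del: sum.lessThan_Suc)
      finally show ?thesis by simp
    qed
    have unique: "v j = 0"
      if "v 0 = 0" "\<And>j. j < Suc d \<Longrightarrow> (\<Sum>l<Suc d. v l * P $$ (l, j)) = v j" "j < Suc d" for v j
      using tridiag_left_eigen_eq_0[of "Suc d" c v a b 1 j] that bc(2) Pt by (metis less_irrefl mult_1)
    have pi0: "\<pi> $ 0 \<noteq> 0"
    proof
      assume "\<pi> $ 0 = 0"
      then have "\<pi> $ j = 0" if "j < Suc d" for j
        using unique[of "\<lambda>j. \<pi> $ j"] pi(3) that by blast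
      then show False using pi(2) by simp
    qed
    \<comment> \<open>This combination of two left fixed vectors is chosen to vanish at state 0, so
      \<open>unique\<close> makes it 0.\<close>
    have proportional: "?r 0 * \<pi> $ j - \<pi> $ 0 * ?r j = 0" if "j < Suc d" for j
    proof (rule unique[of "\<lambda>j. ?r 0 * \<pi> $ j - \<pi> $ 0 * ?r j", OF _ _ that])
      fix j assume j: "j < Suc d"
      have "(\<Sum>l<Suc d. (?r 0 * \<pi> $ l - \<pi> $ 0 * ?r l) * P $$ (l, j)) =
          ?r 0 * (\<Sum>l<Suc d. \<pi> $ l * P $$ (l, j)) - \<pi> $ 0 * (\<Sum>l<Suc d. ?r l * P $$ (l, j))"
        unfolding sum_distrib_left sum_subtractf[symmetric] by (simp add: algebra_simps)
      then show "(\<Sum>l<Suc d. (?r 0 * \<pi> $ l - \<pi> $ 0 * ?r l) * P $$ (l, j)) = ?r 0 * \<pi> $ j - \<pi> $ 0 * ?r j"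
        using pi(3)[OF j] r[OF j] by simp
    qed simp
    \<comment> \<open>Both vectors have total mass 1, so summing the proportionality over all states
      fixes the ratio as 1.\<close>
    have "0 = (\<Sum>j<Suc d. ?r 0 * \<pi> $ j - \<pi> $ 0 * ?r j)"
      by (rule sum.neutral[symmetric]) (use proportional in auto)
    also have "\<dots> = ?r 0 * (\<Sum>j<Suc d. \<pi> $ j) - \<pi> $ 0 * (\<Sum>j<Suc d. ?r j)"
      unfolding sum_distrib_left sum_subtractf[symmetric] ..
    finally have r0: "?r 0 = \<pi> $ 0" unfolding pi(2) sum_r by simp
    have "?r j = \<pi> $ j" if "j < Suc d" for j
      using proportional[OF that] pi0 unfolding r0 by simp
    then show ?thesis
      using Q[of d] pi(1) that by (intro eq_vecI) auto
  qed
  with sto show ?thesis by blast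
qed

end
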